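(* Every oriented ray with an unbounded representing sequence is not ubiquitous.
   Context: An oriented ray is a digraph whose underlying undirected graph is a ray (one-way infinite path) with first vertex the unique vertex of undirected degree $1$. An arc is in-oriented if it points towards the first vertex and out-oriented otherwise. A phase is a maximal consistently directed path (dipath) contained in the ray; its length is its number of arcs. For an oriented ray with infinitely many in-oriented and infinitely many out-oriented arcs, its representing sequence is the sequence whose $n$-th term is the length of the $n$-th phase, counted from the first vertex; it is unbounded if no $b\in\mathbb N$ bounds all its terms. A digraph $H$ is ubiquitous if every digraph which, for every $k\in\mathbb N$, contains $k$ pairwise vertex-disjoint subdigraphs isomorphic to $H$ also contains infinitely many pairwise vertex-disjoint subdigraphs isomorphic to $H$. *)

theory Defs
  imports
    "Graph_Theory.Digraph_Component"
    "Graph_Theory.Digraph_Isomorphism"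
    "HOL-Library.Infinite_Set"
begin

text \<open>
  Digraphs are loopless and without parallel arcs, possibly infinite and possibly with pairs of
  antiparallel arcs, i.e. they are instances of \<^locale>\<open>pair_loopfree_digraph\<close>
  (\<^locale>\<open>pair_digraph\<close> would force finiteness).
  As usual in this library, undirected graphs are symmetric digraphs.
\<close>

definition enumerates_ray :: "(nat \<Rightarrow> 'a) \<Rightarrow> 'a pair_pre_digraph \<Rightarrow> bool" where
  "enumerates_ray v U \<longleftrightarrow> inj v \<and> pverts U = range v \<and>
     parcs U = (\<Union>n. {(v n, v (Suc n)), (v (Suc n), v n)})"

text \<open>
  Antisymmetry excludes antiparallel arcs, which \<^const>\<open>mk_symmetric\<close> would merge
  into a single undirected edge.
\<close>

definition oriented_ray :: "'a pair_pre_digraph \<Rightarrow> bool" where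
  "oriented_ray R \<longleftrightarrow> pair_loopfree_digraph R \<and> antisym (parcs R) \<and>
     (\<exists>v. enumerates_ray v (mk_symmetric R))"

text \<open>
  The enumeration is unique, since it has to start in the only vertex of undirected degree 1;
  thus \<open>ray_vertex R 0\<close> is the first vertex of \<open>R\<close>.
\<close>

definition ray_vertex :: "'a pair_pre_digraph \<Rightarrow> nat \<Rightarrow> 'a" where
  "ray_vertex R = (THE v. enumerates_ray v (mk_symmetric R))"

definition in_oriented_arcs :: "'a pair_pre_digraph \<Rightarrow> ('a \<times> 'a) set" where
  "in_oriented_arcs R = {e \<in> parcs R. \<exists>n. e = (ray_vertex R (Suc n), ray_vertex R n)}"

definition out_oriented_arcs :: "'a pair_pre_digraph \<Rightarrow> ('a \<times> 'a) set" where
  "out_oriented_arcs R = parcs R - in_oriented_arcs R"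

definition dipath :: "('a, 'b) pre_digraph \<Rightarrow> bool" where
  "dipath P \<longleftrightarrow> (\<exists>u p w. pre_digraph.apath P u p w \<and>
     verts P = set (pre_digraph.awalk_verts P u p) \<and> arcs P = set p)"

definition phases :: "'a pair_pre_digraph \<Rightarrow> ('a, 'a \<times> 'a) pre_digraph set" where
  "phases R = {P. pre_digraph.max_subgraph R dipath P}"

definition phase_start :: "'a pair_pre_digraph \<Rightarrow> ('a, 'a \<times> 'a) pre_digraph \<Rightarrow> nat" where
  "phase_start R P = (LEAST n. ray_vertex R n \<in> verts P)"

text \<open>
  Distinct phases start at distinct positions of the ray; counting starts with 0.
  \<open>nth_phase\<close> and \<open>representing_sequence\<close> are meaningful only if there are infinitely many
  in-oriented and infinitely many out-oriented arcs.
\<close>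

definition nth_phase :: "'a pair_pre_digraph \<Rightarrow> nat \<Rightarrow> ('a, 'a \<times> 'a) pre_digraph" where
  "nth_phase R n =
     (THE P. P \<in> phases R \<and> phase_start R P = enumerate (phase_start R ` phases R) n)"

definition representing_sequence :: "'a pair_pre_digraph \<Rightarrow> nat \<Rightarrow> nat" where
  "representing_sequence R n = card (arcs (nth_phase R n))"

definition unbounded_seq :: "(nat \<Rightarrow> nat) \<Rightarrow> bool" where
  "unbounded_seq s \<longleftrightarrow> \<not> (\<exists>b. \<forall>n. s n \<le> b)"

definition disjoint_copies ::
  "'a pair_pre_digraph \<Rightarrow> 'b pair_pre_digraph \<Rightarrow> ('b, 'b \<times> 'b) pre_digraph set \<Rightarrow> bool" where
  "disjoint_copies H G F \<longleftrightarrow> (\<forall>K\<in>F. subgraph K G \<and> digraph_iso H K) \<and>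
     pairwise (\<lambda>K L. disjnt (verts K) (verts L)) F"

text \<open>
  The first argument fixes the type over which the vertices of the host digraphs range,
  as HOL cannot quantify over all types inside a definition.
\<close>

definition ubiquitous :: "'b itself \<Rightarrow> 'a pair_pre_digraph \<Rightarrow> bool" where
  "ubiquitous (_ :: 'b itself) H \<longleftrightarrow>
     (\<forall>G :: 'b pair_pre_digraph. pair_loopfree_digraph G \<longrightarrow>
        (\<forall>k. \<exists>F. disjoint_copies H G F \<and> finite F \<and> card F = k) \<longrightarrow>
        (\<exists>F. disjoint_copies H G F \<and> infinite F))"

end

theory Submission
  imports Defs
begin

text \<open>
  The host digraph is a union of copies of the ray, arranged in families: family \<open>k\<close> consists of \<open>k\<close>
  disjoint copies, while any two copies from different families meet infinitely often. They meet only
  inside sparse, record-length phases, called stations, where the second vertex of the phase on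
  one ray is identified with the third vertex of that phase on the other.

  Follow a copy \<open>S\<close> of the ray through the host and compare the number of the phase it is currently
  running through in the host with the number of its own phase. This slack never increases, since
  leaving a phase of the host other than through its end costs at least one phase of \<open>S\<close>; and it is
  never negative, since a record phase of \<open>S\<close> does not fit into the earlier phases of the host. So the
  slack is eventually constant and \<open>S\<close> eventually runs through the phases of the host one by one. A
  positive slack \<open>m\<close> would make the phase lengths \<open>m\<close>-periodic between stations, which contradicts
  the size of the records. With slack 0, changing the ray at a station would give a phase whose length
  is off by one. Hence \<open>S\<close> eventually follows a single ray of the host, and disjoint copies follow
  different rays of one and the same family.
\<close>

section \<open>Phases of an orientation pattern\<close>

text \<open>
  \<open>ori t\<close> tells whether the \<open>t\<close>-th arc of a ray is out-oriented. The \<open>t\<close>-th arc lies in phase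
  \<open>ph t\<close>, and phase \<open>n\<close> consists of the arcs \<open>st n, \<dots>, st n + len n - 1\<close>.
\<close>

locale alternating =
  fixes ori :: "nat \<Rightarrow> bool"
  assumes alternates: "\<exists>m\<ge>n. ori m \<noteq> ori (Suc m)"
begin

primrec ph :: "nat \<Rightarrow> nat" where
  "ph 0 = 0"
| "ph (Suc t) = (if ori t = ori (Suc t) then ph t else Suc (ph t))"

definition st :: "nat \<Rightarrow> nat" where
  "st n = (LEAST t. ph t = n)"

definition len :: "nat \<Rightarrow> nat" where
  "len n = st (Suc n) - st n"

lemma ph_mono: "s \<le> t \<Longrightarrow> ph s \<le> ph t"
  by (rule lift_Suc_mono_le[of ph]) auto

lemma ph_surj: "\<exists>t. ph t = n"
proof (induction n)
  case 0
  show ?case by (rule exI[of _ 0]) simp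
next
  case (Suc n)
  then obtain t where t: "ph t = n" by blast
  define m where "m = (LEAST m. m \<ge> t \<and> ori m \<noteq> ori (Suc m))"
  have m: "m \<ge> t \<and> ori m \<noteq> ori (Suc m)"
    unfolding m_def by (rule LeastI_ex) (use alternates in blast)
  have const: "j \<le> m \<Longrightarrow> ph j = n" if "t \<le> j" for j
    using that
  proof (induction j rule: dec_induct)
    case base
    then show ?case using t by simp
  next
    case (step j)
    have "\<not> (j \<ge> t \<and> ori j \<noteq> ori (Suc j))"
      using not_less_Least[of j "\<lambda>m. m \<ge> t \<and> ori m \<noteq> ori (Suc m)"] step.prems
      unfolding m_def by simp
    then show ?case using step by simp
  qed
  have "ph (Suc m) = Suc n" using const[of m] m by simp
  then show ?case ..
qed

lemma ph_st [simp]: "ph (st n) = n"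
  unfolding st_def by (rule LeastI_ex) (rule ph_surj)

lemma st_le: "n \<le> ph t \<Longrightarrow> st n \<le> t"
proof (rule ccontr)
  assume "n \<le> ph t" "\<not> st n \<le> t"
  then have "ph t = n" using ph_mono[of t "st n"] by simp
  then have "st n \<le> t" unfolding st_def by (rule Least_le)
  then show False using \<open>\<not> st n \<le> t\<close> by simp
qed

lemma st_le_iff: "st n \<le> t \<longleftrightarrow> n \<le> ph t"
  using st_le ph_mono[of "st n" t] by auto

lemma ph_eq_iff: "ph t = n \<longleftrightarrow> st n \<le> t \<and> t < st (Suc n)"
  using st_le_iff[of n t] st_le_iff[of "Suc n" t] by auto

lemma strict_mono_st: "strict_mono st"
  unfolding strict_mono_Suc_iff by (metis ph_eq_iff ph_st)

lemma st_less_iff [simp]: "st m < st n \<longleftrightarrow> m < n"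
  by (rule strict_mono_less[OF strict_mono_st])

lemma st_0 [simp]: "st 0 = 0"
  using st_le[of 0 0] by simp

lemma st_Suc: "st (Suc n) = st n + len n"
  unfolding len_def by (simp add: less_imp_le)

lemma len_pos: "0 < len n"
  unfolding len_def by simp

lemma ori_eq_if_ph_eq:
  assumes "ph s = ph t"
  shows "ori s = ori t"
proof -
  have *: "ph s = ph t \<longrightarrow> ori s = ori t" if "s \<le> t" for s t
    using that
  proof (induction t rule: dec_induct)
    case (step t)
    then show ?case using ph_mono[of s t] by auto
  qed simp
  show ?thesis
    using *[of s t] *[of t s] assms by (metis nle_le)
qed

lemma ori_change_iff: "ori t \<noteq> ori (Suc t) \<longleftrightarrow> Suc t = st (Suc (ph t))"
proof
  assume "ori t \<noteq> ori (Suc t)"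
  then have "ph (Suc t) = Suc (ph t)" by simp
  then have "st (Suc (ph t)) \<le> Suc t" by (simp add: st_le_iff)
  moreover have "t < st (Suc (ph t))" using ph_eq_iff by blast
  ultimately show "Suc t = st (Suc (ph t))" by simp
next
  assume "Suc t = st (Suc (ph t))"
  then have "ph (Suc t) = Suc (ph t)" by (metis ph_st)
  then show "ori t \<noteq> ori (Suc t)" by (auto split: if_splits)
qed

lemma ph_le_self: "ph t \<le> t"
  by (induction t) auto

lemma le_st: "n \<le> st n"
  using ph_le_self[of "st n"] by simp

end

text \<open>The margin 2 in \<open>jump\<close> survives a correction of one caused by an
  identification, and its range up to twice the previous station leaves room for one period of
  length at most \<open>N s\<close>. By \<open>long\<close>, the vertices identified at a station
  are interior to its phase.\<close>

locale stations = alternating ori for ori +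
  fixes N :: "nat \<Rightarrow> nat"
  assumes strict_record: "j < N s \<Longrightarrow> len j < len (N s)"
    and jump: "j \<le> 2 * N s + 1 \<Longrightarrow> len j + 2 \<le> len (N (Suc s))"
    and long: "3 \<le> len (N s)"
begin

lemma N_Suc: "2 * N s + 1 < N (Suc s)"
  using jump[of "N (Suc s)" s] by force

lemma strict_mono_N: "strict_mono N"
  unfolding strict_mono_Suc_iff
proof
  fix s show "N s < N (Suc s)" using N_Suc[of s] by simp
qed

lemma N_eq_iff [simp]: "N s = N s' \<longleftrightarrow> s = s'"
  by (rule strict_mono_eq[OF strict_mono_N])

lemma le_N: "s \<le> N s"
  by (rule strict_mono_imp_increasing[OF strict_mono_N])

lemma record_station:
  assumes "N s' < N s"
  shows "len (N s') + 1 < len (N s)"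
proof -
  have "s' < s" using assms strict_mono_less[OF strict_mono_N] by blast
  then obtain s'' where s'': "s = Suc s''" "s' \<le> s''" by (cases s) auto
  then have "N s' \<le> N s''" using strict_mono_less_eq[OF strict_mono_N] by blast
  then show ?thesis using jump[of "N s'" s''] s'' by simp
qed

text \<open>On the ray \<open>A s\<close> the vertex \<open>crossing s\<close> is identified, on
  \<open>B s\<close> the vertex after it. This offset makes changing the ray visible in the length
  of the phase.\<close>

definition crossing :: "nat \<Rightarrow> nat" where
  "crossing s = Suc (st (N s))"

lemma crossing_eq_iff [simp]: "crossing s = crossing s' \<longleftrightarrow> s = s'"
  unfolding crossing_def using strict_mono_eq[OF strict_mono_st] by simp

text \<open>No vertex takes part in two identifications, so the classes of identified vertices have
  at most two elements.\<close>

lemma crossing_neq_Suc: "crossing s \<noteq> Suc (crossing s')"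
proof
  assume eq: "crossing s = Suc (crossing s')"
  have "st (N s) = Suc (st (N s'))" using eq by (simp add: crossing_def)
  moreover have "ph (Suc (st (N s'))) = N s'"
    unfolding ph_eq_iff st_Suc using long[of s'] by simp
  ultimately show False by (metis n_not_Suc_n ph_st)
qed

lemma ph_near_crossing:
  assumes "x \<le> Suc (crossing s)" "crossing s \<le> Suc x"
  shows "ph x = N s"
  using assms long[of s] unfolding ph_eq_iff st_Suc crossing_def by simp

end

lemma (in alternating) stations_exist:
  assumes "\<And>b. \<exists>n. b \<le> len n"
  shows "\<exists>N. stations ori N"
proof -
  have rec: "\<exists>n. b \<le> len n \<and> (\<forall>j<n. len j < len n)" for b
  proof -
    \<comment> \<open>The first phase of length at least \<open>b\<close> is a strict record, all
      earlier ones being shorter than \<open>b\<close>.\<close>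
    define n where "n = (LEAST n. b \<le> len n)"
    have "b \<le> len n" unfolding n_def by (rule LeastI_ex) (rule assms)
    moreover have "len j < b" if "j < n" for j
      using not_less_Least[of j "\<lambda>n. b \<le> len n"] that by (simp add: n_def)
    ultimately show ?thesis by (meson less_le_trans)
  qed
  let ?P = "\<lambda>n. 3 \<le> len n \<and> (\<forall>j<n. len j < len n)"
  have "\<exists>N. \<forall>s. ?P (N s) \<and> (\<forall>j\<le>2 * N s + 1. len j + 2 \<le> len (N (Suc s)))"
  proof (rule dependent_nat_choice)
    show "\<exists>n. ?P n" by (rule rec)
    fix n :: nat and s :: nat
    let ?M = "Max (len ` {..2 * n + 1})"
    \<comment> \<open>The summand 3 serves both the margin in \<open>jump\<close> and the minimal
      length in \<open>long\<close>.\<close>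
    obtain n' where n': "?M + 3 \<le> len n'" "\<forall>j<n'. len j < len n'" using rec by blast
    have "len j + 2 \<le> len n'" if "j \<le> 2 * n + 1" for j
    proof -
      have "len j \<le> ?M" by (rule Max_ge) (use that in auto)
      then show ?thesis using n'(1) by linarith
    qed
    then show "\<exists>n'. ?P n' \<and> (\<forall>j\<le>2 * n + 1. len j + 2 \<le> len n')" using n' by (intro exI[of _ n']) simp
  qed
  then obtain N where "\<forall>s. ?P (N s) \<and> (\<forall>j\<le>2 * N s + 1. len j + 2 \<le> len (N (Suc s)))" by blast
  then have "stations ori N" by unfold_locales auto
  then show ?thesis by blast
qed

text \<open>\<open>f r t\<close> is the \<open>t\<close>-th vertex of the copy \<open>r\<close> of
  the ray; station \<open>s\<close> joins the copies \<open>A s\<close> and \<open>B s\<close> in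
  one vertex, and there are no other coincidences.\<close>

locale crossing_rays = stations ori N for ori N +
  fixes A B :: "nat \<Rightarrow> 'r" and f :: "'r \<Rightarrow> nat \<Rightarrow> 'b"
  assumes A_neq_B: "A s \<noteq> B s"
    and f_eq_iff: "f r t = f r' t' \<longleftrightarrow> r = r' \<and> t = t' \<or>
      (\<exists>s. (r, t) = (A s, crossing s) \<and> (r', t') = (B s, Suc (crossing s)) \<or>
           (r', t') = (A s, crossing s) \<and> (r, t) = (B s, Suc (crossing s)))"

section \<open>Rays in the host digraph\<close>

text \<open>
  The \<open>i\<close>-th arc of the ray \<open>S\<close> is the \<open>x i\<close>-th arc of the ray \<open>f (r i)\<close>; it is traversed
  away from the first vertex of \<open>f (r i)\<close> iff \<open>up i\<close>.
\<close>

locale traced_ray = crossing_rays ori N A B f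
  for ori N and A B :: "nat \<Rightarrow> 'r" and f :: "'r \<Rightarrow> nat \<Rightarrow> 'b" +
  fixes S :: "nat \<Rightarrow> 'b" and r :: "nat \<Rightarrow> 'r" and x :: "nat \<Rightarrow> nat" and up :: "nat \<Rightarrow> bool"
  assumes S_start: "S i = f (r i) (if up i then x i else Suc (x i))"
    and S_end: "S (Suc i) = f (r i) (if up i then Suc (x i) else x i)"
    and ori_x: "ori (x i) \<longleftrightarrow> ori i = up i"
begin

text \<open>
  The correction \<open>delta\<close> makes the height of identified vertices agree, so that the height changes by
  exactly one with each step along a dipath, even when the dipath changes the ray at a station.
\<close>

definition delta :: "nat \<Rightarrow> 'r \<Rightarrow> nat" where
  "delta p \<rho> = (if \<exists>s. p = N s \<and> \<rho> = B s then 1 else 0)"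

lemma delta_le: "delta p \<rho> \<le> 1"
  by (simp add: delta_def)

lemma delta_not_station: "p \<notin> range N \<Longrightarrow> delta p \<rho> = 0"
  by (auto simp: delta_def)

lemma delta_station [simp]: "delta (N s) (A s) = 0" "delta (N s) (B s) = 1"
  using A_neq_B by (auto simp: delta_def)

definition height :: "nat \<Rightarrow> int" where
  "height i = int (x i) - int (delta (ph (x i)) (r i))"

text \<open>Two consecutive arcs of \<open>S\<close> share a vertex, and \<open>f_eq_iff\<close>
  compares its positions on the two host rays. If the rays differ, it is an identified vertex, and
  all arcs incident with it belong to the phase \<open>N s\<close>.\<close>

lemma step_cases:
  obtains (same) "r (Suc i) = r i"
      "(if up i then Suc (x i) else x i) = (if up (Suc i) then x (Suc i) else Suc (x (Suc i)))"
  | (cross) s where "ph (x i) = N s" "ph (x (Suc i)) = N s"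
      "r i = A s \<and> r (Suc i) = B s \<and> (if up i then Suc (x i) else x i) = crossing s \<and>
          (if up (Suc i) then x (Suc i) else Suc (x (Suc i))) = Suc (crossing s) \<or>
       r i = B s \<and> r (Suc i) = A s \<and> (if up i then Suc (x i) else x i) = Suc (crossing s) \<and>
          (if up (Suc i) then x (Suc i) else Suc (x (Suc i))) = crossing s"
proof -
  let ?y = "if up i then Suc (x i) else x i"
  let ?z = "if up (Suc i) then x (Suc i) else Suc (x (Suc i))"
  have "f (r i) ?y = f (r (Suc i)) ?z"
    using S_end[of i] S_start[of "Suc i"] by simp
  then consider "r i = r (Suc i)" "?y = ?z"
    | s where "r i = A s \<and> r (Suc i) = B s \<and> ?y = crossing s \<and> ?z = Suc (crossing s) \<or>
       r i = B s \<and> r (Suc i) = A s \<and> ?y = Suc (crossing s) \<and> ?z = crossing s"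
    unfolding f_eq_iff by auto
  then show ?thesis
  proof cases
    case 1
    then show ?thesis by (intro same) auto
  next
    case (2 s)
    have "ph (x i) = N s" "ph (x (Suc i)) = N s"
      by (rule ph_near_crossing; use 2 in \<open>auto split: if_splits\<close>)+
    then show ?thesis using 2 by (rule cross)
  qed
qed

text \<open>On one host ray, reversing the traversal would repeat the same arc, which contradicts
  the equal orientations. When the ray changes, both arcs lie in phase \<open>N s\<close>, hence
  have the same host orientation, and \<open>delta\<close> absorbs the offset.\<close>

lemma step_straight:
  assumes "ori i = ori (Suc i)"
  shows "up (Suc i) = up i" "ph (x (Suc i)) = ph (x i)"
    "height (Suc i) = height i + (if up i then 1 else -1)"
    "r (Suc i) = r i \<or> (\<exists>s. ph (x i) = N s \<and> r i \<in> {A s, B s} \<and> r (Suc i) \<in> {A s, B s})"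
proof -
  have "up (Suc i) = up i \<and> ph (x (Suc i)) = ph (x i) \<and>
     height (Suc i) = height i + (if up i then 1 else -1) \<and>
     (r (Suc i) = r i \<or> (\<exists>s. ph (x i) = N s \<and> r i \<in> {A s, B s} \<and> r (Suc i) \<in> {A s, B s}))"
  proof (cases i rule: step_cases)
    case same
    have up: "up (Suc i) = up i" using same(2) ori_x[of i] ori_x[of "Suc i"] assms
      by (auto split: if_splits)
    have o: "ori (x (Suc i)) = ori (x i)" using ori_x[of i] ori_x[of "Suc i"] assms up by auto
    have p: "ph (x (Suc i)) = ph (x i)"
    proof (cases "up i")
      case True
      then have "x (Suc i) = Suc (x i)" using same(2) up by simp
      then show ?thesis using o by simp
    next
      case False
      then have "x i = Suc (x (Suc i))" using same(2) up by simp
      then show ?thesis using o by simp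
    qed
    show ?thesis using up p same by (auto simp: height_def)
  next
    case (cross s)
    have "ori (x i) = ori (x (Suc i))" using cross by (intro ori_eq_if_ph_eq) simp
    then have up: "up (Suc i) = up i" using ori_x[of i] ori_x[of "Suc i"] assms by auto
    show ?thesis using cross up by (auto simp: height_def)
  qed
  then show "up (Suc i) = up i" "ph (x (Suc i)) = ph (x i)"
    "height (Suc i) = height i + (if up i then 1 else -1)"
    "r (Suc i) = r i \<or> (\<exists>s. ph (x i) = N s \<and> r i \<in> {A s, B s} \<and> r (Suc i) \<in> {A s, B s})"
    by auto
qed

text \<open>Only an upward move along a single host ray can enter a later phase, and then by one; a
  change of ray stays in its phase, and any other move does not increase the position.\<close>

lemma step_turn:
  assumes "ori i \<noteq> ori (Suc i)"
  shows "up i \<and> up (Suc i) \<and> r (Suc i) = r i \<and> x (Suc i) = Suc (x i) \<and>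
      ph (x (Suc i)) = Suc (ph (x i)) \<or> ph (x (Suc i)) \<le> ph (x i)"
proof (cases i rule: step_cases)
  case same
  show ?thesis
  proof (cases "up i \<and> up (Suc i)")
    case True
    then have "ori (x i) \<noteq> ori (x (Suc i))" using ori_x[of i] ori_x[of "Suc i"] assms by auto
    moreover have "x (Suc i) = Suc (x i)" using True same(2) by simp
    ultimately show ?thesis using True same(1) by simp
  next
    case False
    then have "x (Suc i) \<le> x i" using same(2) by (auto split: if_splits)
    then show ?thesis by (auto dest: ph_mono)
  qed
qed simp

text \<open>One phase of \<open>S\<close> stays in one host phase, so at most one station is
  involved and the ray can only alternate between its two rays.\<close>

lemma run_straight:
  assumes "i \<le> j" "ph i = ph j"
  shows "up j = up i \<and> ph (x j) = ph (x i) \<and>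
    height j = height i + (if up i then 1 else -1) * (int j - int i) \<and>
    (r j = r i \<or> (\<exists>s. ph (x i) = N s \<and> r i \<in> {A s, B s} \<and> r j \<in> {A s, B s}))"
  using assms
proof (induction j rule: dec_induct)
  case (step j)
  have "ph i \<le> ph j" "ph j \<le> ph (Suc j)" using step.hyps by (simp_all add: ph_mono del: ph.simps)
  then have eq: "ph i = ph j" "ph (Suc j) = ph j" using step.prems by auto
  then have o: "ori j = ori (Suc j)" by (auto split: if_splits)
  have IH: "up j = up i" "ph (x j) = ph (x i)"
      "height j = height i + (if up i then 1 else -1) * (int j - int i)"
      "r j = r i \<or> (\<exists>s. ph (x i) = N s \<and> r i \<in> {A s, B s} \<and> r j \<in> {A s, B s})"
    using step.IH[OF eq(1)] by blast+
  note straight = step_straight[OF o]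
  have "height (Suc j) = height i + (if up i then 1 else -1) * (int (Suc j) - int i)"
    using IH(1,3) straight(3) by (cases "up i") simp_all
  moreover have "r (Suc j) = r i \<or>
      (\<exists>s. ph (x i) = N s \<and> r i \<in> {A s, B s} \<and> r (Suc j) \<in> {A s, B s})"
  proof (cases "r (Suc j) = r j")
    case True
    then show ?thesis using IH(4) by simp
  next
    case False
    then obtain s where "ph (x i) = N s" "r j \<in> {A s, B s}" "r (Suc j) \<in> {A s, B s}"
      using straight(4) IH(2) by auto
    moreover have "r i \<in> {A s, B s}"
      using IH(4) calculation(1,2) by (metis N_eq_iff)
    ultimately show ?thesis by blast
  qed
  ultimately show ?case using IH(1,2) straight(1,2) by (intro conjI) simp_all
qed simp

text \<open>Running through its phase \<open>N s\<close>, \<open>S\<close> changes height by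
  \<open>len (N s) - 1\<close> inside a single host phase \<open>?p\<close>. An earlier phase is too
  short for this, even with the corrections.\<close>

lemma ph_x_ge_station: "N s \<le> ph (x (st (N s)))"
proof (rule ccontr)
  let ?i = "st (N s)" and ?j = "st (N s) + len (N s) - 1"
  let ?p = "ph (x ?i)"
  assume "\<not> N s \<le> ?p"
  then have less: "?p < N s" by simp
  have "ph ?j = N s" using len_pos[of "N s"] unfolding ph_eq_iff st_Suc by simp
  then have run: "ph (x ?j) = ?p" "\<bar>height ?j - height ?i\<bar> = int (len (N s)) - 1"
    using run_straight[of ?i ?j] len_pos[of "N s"] by auto
  have "st ?p \<le> x ?i" "x ?i < st ?p + len ?p" "st ?p \<le> x ?j" "x ?j < st ?p + len ?p"
    using ph_eq_iff[of "x ?i" ?p] ph_eq_iff[of "x ?j" ?p] run(1) by (simp_all add: st_Suc)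
  then have diff: "int (len (N s)) - 1 \<le> int (len ?p) - 1 + \<bar>int (delta ?p (r ?i)) - int (delta ?p (r ?j))\<bar>"
    using run unfolding height_def by simp
  moreover have "\<bar>int (delta ?p (r ?i)) - int (delta ?p (r ?j))\<bar> \<le> 1"
    using delta_le[of ?p "r ?i"] delta_le[of ?p "r ?j"] by linarith
  ultimately have bound: "len (N s) \<le> len ?p + 1" by linarith
  \<comment> \<open>The correction can be nonzero only at a station, where the record exceeds
    earlier stations by at least two; elsewhere a strict record suffices.\<close>
  show False
  proof (cases "?p \<in> range N")
    case True
    then obtain s' where "?p = N s'" by blast
    then show False using record_station[of s' s] less bound by simp
  next
    case False
    then show False using diff strict_record[OF less] by (simp add: delta_not_station)
  qed
qed

section \<open>The slack between host phases and phases of the ray\<close>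

lemma slack_step: "int (ph (x (Suc i))) - int (ph (Suc i)) \<le> int (ph (x i)) - int (ph i)"
  using step_straight[of i] step_turn[of i] by (cases "ori i = ori (Suc i)") auto

lemma slack_antimono:
  "i \<le> j \<Longrightarrow> int (ph (x j)) - int (ph j) \<le> int (ph (x i)) - int (ph i)"
  by (rule lift_Suc_antimono_le[of "\<lambda>i. int (ph (x i)) - int (ph i)"]) (rule slack_step)

text \<open>A negative slack would persist up to the next station of \<open>S\<close>, contradicting
  \<open>ph_x_ge_station\<close>.\<close>

lemma ph_x_ge: "ph i \<le> ph (x i)"
proof -
  have "i \<le> st (N i)" using le_N[of i] le_st[of "N i"] by simp
  then show ?thesis using slack_antimono[of i "st (N i)"] ph_x_ge_station[of i] by simp
qed

lemma slack_eventually_const: "\<exists>T m. \<forall>i\<ge>T. ph (x i) = ph i + m"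
proof -
  \<comment> \<open>By \<open>ph_x_ge\<close> the subtraction is not truncated, so the slack has a
    least value, and it keeps this value once attained.\<close>
  let ?sl = "\<lambda>i. ph (x i) - ph i"
  obtain T where T: "\<And>i. ?sl T \<le> ?sl i"
    using ex_has_least_nat[of "\<lambda>_. True" 0 ?sl] by auto
  have "ph (x i) = ph i + ?sl T" if "i \<ge> T" for i
    using T[of i] slack_antimono[OF that] ph_x_ge[of i] ph_x_ge[of T] by linarith
  then show ?thesis by blast
qed

lemma slack_zero: "\<exists>n0. \<forall>n\<ge>n0. x (st n) = st n \<and> up (st n) \<and> r (st (Suc n)) = r (st n)"
proof -
  obtain T m where slack: "\<And>i. i \<ge> T \<Longrightarrow> ph (x i) = ph i + m"
    using slack_eventually_const by blast
  \<comment> \<open>Constant slack excludes the second alternative of \<open>step_turn\<close>: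
    whenever \<open>S\<close> turns, it moves up along the same host ray into the first arc of the
    next host phase.\<close>
  have turn: "x (st (Suc n)) = st (Suc n + m)" "up (st (Suc n))"
      "r (st (Suc n)) = r (st (Suc n) - 1)" "x (st (Suc n)) = Suc (x (st (Suc n) - 1))"
      "up (st (Suc n) - 1)"
    if "n \<ge> T" for n
  proof -
    define i where "i = st (Suc n) - 1"
    have i: "Suc i = st (Suc n)" using len_pos[of n] by (simp add: i_def st_Suc)
    have phi: "ph i = n" using i len_pos[of n] unfolding ph_eq_iff by (simp add: st_Suc)
    then have o: "ori i \<noteq> ori (Suc i)" unfolding ori_change_iff using i by simp
    have iT: "i \<ge> T" using le_st[of "Suc n"] i that by simp
    have px: "ph (x i) = n + m" "ph (x (Suc i)) = Suc n + m"
      using slack[of i] slack[of "Suc i"] iT phi i by (simp_all del: ph.simps)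
    then have *: "up i" "up (Suc i)" "r (Suc i) = r i" "x (Suc i) = Suc (x i)"
      using step_turn[OF o] by auto
    have "ori (x i) \<noteq> ori (Suc (x i))" using px * by (auto split: if_splits)
    then have "x (Suc i) = st (Suc n + m)" using ori_change_iff[of "x i"] px * by simp
    then show "x (st (Suc n)) = st (Suc n + m)" "up (st (Suc n))"
      "r (st (Suc n)) = r (st (Suc n) - 1)" "x (st (Suc n)) = Suc (x (st (Suc n) - 1))"
      "up (st (Suc n) - 1)"
      using * i unfolding i_def[symmetric] by auto
  qed
  \<comment> \<open>Phase \<open>n\<close> of \<open>S\<close> traverses host phase
    \<open>n + m\<close> from its first to its last arc. Comparing the heights at both ends shows
    that the lengths agree up to the corrections.\<close>
  have pass: "len n + delta (n + m) (r (st (Suc n))) = len (n + m) + delta (n + m) (r (st n))"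
    "r (st (Suc n)) = r (st n) \<or>
      (\<exists>s. n + m = N s \<and> r (st n) \<in> {A s, B s} \<and> r (st (Suc n)) \<in> {A s, B s})"
    if n: "n > T" for n
  proof -
    define j where "j = st (Suc n) - 1"
    have j: "Suc j = st (Suc n)" using len_pos[of n] by (simp add: j_def st_Suc)
    have phj: "ph j = n" using j len_pos[of n] unfolding ph_eq_iff by (simp add: st_Suc)
    have le: "st n \<le> j" using j len_pos[of n] by (simp add: st_Suc)
    obtain n' where n': "n = Suc n'" "n' \<ge> T" using n by (cases n) auto
    note start = turn[OF n'(2), folded n'(1)]
    note stop = turn[of n, folded j_def]
    have px: "ph (x (st n)) = n + m" using start by simp
    have run: "ph (x j) = n + m" "height j = height (st n) + (int j - int (st n))"
      "r j = r (st n) \<or> (\<exists>s. n + m = N s \<and> r (st n) \<in> {A s, B s} \<and> r j \<in> {A s, B s})"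
      using run_straight[OF le] phj start(2) px by auto
    have rj: "r (st (Suc n)) = r j" using stop n by simp
    have xj: "Suc (x j) = st (n + m) + len (n + m)" using stop n by (simp add: st_Suc)
    show "len n + delta (n + m) (r (st (Suc n))) = len (n + m) + delta (n + m) (r (st n))"
      using run(1,2) xj start(1) px j st_Suc[of n] unfolding height_def rj by simp
    show "r (st (Suc n)) = r (st n) \<or>
      (\<exists>s. n + m = N s \<and> r (st n) \<in> {A s, B s} \<and> r (st (Suc n)) \<in> {A s, B s})"
      using run(3) rj by simp
  qed
  have "m = 0"
  proof (rule ccontr)
    assume m: "m \<noteq> 0"
    \<comment> \<open>So large that the slack is already constant at phase \<open>N s\<close> and
      that \<open>N s + m\<close> does not exceed \<open>2 * N s\<close>, the range covered by
      \<open>jump\<close>.\<close>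
    define s where "s = T + m"
    have Ns: "T + m \<le> N s" using le_N[of s] by (simp add: s_def)
    \<comment> \<open>Between two stations no correction occurs, so \<open>pass\<close> gives
      \<open>len (j - m) = len j\<close>, and descending by \<open>m\<close> ends among the phases
      up to \<open>N s + m\<close>.\<close>
    have periodic: "\<exists>j'\<le>N s + m. len j = len j'" if "N s < j" "j < N (Suc s)" for j
      using that
    proof (induction j rule: less_induct)
      case (less j)
      show ?case
      proof (cases "j \<le> N s + m")
        case False
        have "j \<notin> range N"
        proof
          assume "j \<in> range N"
          then obtain s' where "j = N s'" by blast
          then show False using less.prems strict_mono_less[OF strict_mono_N] by auto
        qed
        then have "len (j - m) = len j"
          using pass(1)[of "j - m"] False Ns by (simp add: delta_not_station)
        moreover have "j - m < j" "N s < j - m" "j - m < N (Suc s)"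
          using False m less.prems by auto
        ultimately show ?thesis using less.IH[of "j - m"] by auto
      qed blast
    qed
    have big: "N s + m < N (Suc s)" using N_Suc[of s] Ns by simp
    then have "N s < N (Suc s) - m" "N (Suc s) - m < N (Suc s)" using m by auto
    then obtain j' where j': "j' \<le> N s + m" "len (N (Suc s) - m) = len j'"
      using periodic[of "N (Suc s) - m"] by blast
    have "T < N (Suc s) - m" using big Ns by linarith
    \<comment> \<open>One more shift by \<open>m\<close> reaches the next station itself, now at the
      cost of a correction of at most one, which is below the margin in \<open>jump\<close>.\<close>
    then have "len (N (Suc s)) \<le> len (N (Suc s) - m) + 1"
      using pass(1)[of "N (Suc s) - m"] big Ns delta_le[of "N (Suc s)" "r (st (Suc (N (Suc s) - m)))"]
      by simp
    moreover have "len j' + 2 \<le> len (N (Suc s))" using jump[of j' s] j'(1) Ns by simp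
    ultimately show False using j'(2) by simp
  qed
  have "x (st n) = st n \<and> up (st n) \<and> r (st (Suc n)) = r (st n)" if n: "n > T" for n
  proof -
    obtain n' where n': "n = Suc n'" "n' \<ge> T" using n by (cases n) auto
    \<comment> \<open>With \<open>m = 0\<close> the lengths in \<open>pass\<close> cancel. Since
      \<open>delta\<close> distinguishes \<open>A s\<close> from \<open>B s\<close>, the ray is the
      same at both ends of the phase.\<close>
    have "delta n (r (st (Suc n))) = delta n (r (st n))" using pass(1)[OF n] \<open>m = 0\<close> by simp
    then have "r (st (Suc n)) = r (st n)" using pass(2)[OF n] \<open>m = 0\<close> by auto
    then show ?thesis using turn[OF n'(2)] n'(1) \<open>m = 0\<close> by simp
  qed
  then show ?thesis by (intro exI[of _ "Suc T"]) simp
qed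

text \<open>The first two vertices of a phase are the ends of its first arc. The third one is
  included for \<open>B s\<close> because that is where \<open>B s\<close> meets
  \<open>A s\<close>.\<close>

lemma eventually_follows_ray:
  "\<exists>\<rho>\<in>range r. \<exists>n0. \<forall>n\<ge>n0. S (st n) = f \<rho> (st n) \<and> S (Suc (st n)) = f \<rho> (Suc (st n)) \<and>
     (\<forall>s. n = N s \<longrightarrow> \<rho> = B s \<longrightarrow> S (Suc (Suc (st n))) = f \<rho> (Suc (Suc (st n))))"
proof -
  obtain n0 where n0: "\<And>n. n \<ge> n0 \<Longrightarrow> x (st n) = st n \<and> up (st n) \<and> r (st (Suc n)) = r (st n)"
    using slack_zero by blast
  have r: "r (st n) = r (st n0)" if "n \<ge> n0" for n
    using that by (induction n rule: dec_induct) (auto simp: n0)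
  have "S (st n) = f (r (st n0)) (st n) \<and> S (Suc (st n)) = f (r (st n0)) (Suc (st n)) \<and>
     (\<forall>s. n = N s \<longrightarrow> r (st n0) = B s \<longrightarrow> S (Suc (Suc (st n))) = f (r (st n0)) (Suc (Suc (st n))))"
    if n: "n \<ge> n0" for n
  proof (intro conjI allI impI)
    show 1: "S (st n) = f (r (st n0)) (st n)" "S (Suc (st n)) = f (r (st n0)) (Suc (st n))"
      using S_start[of "st n"] S_end[of "st n"] n0[OF n] r[OF n] by auto
    fix s assume s: "n = N s" "r (st n0) = B s"
    let ?i = "st n"
    have "ph (Suc ?i) = n" unfolding ph_eq_iff st_Suc using long[of s] s by simp
    then have "ori ?i = ori (Suc ?i)" by (intro ori_eq_if_ph_eq) simp
    then have up: "up (Suc ?i)" using step_straight(1) n0[OF n] by blast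
    have "f (B s) (crossing s) = f (r (Suc ?i)) (x (Suc ?i))"
      using 1 s S_start[of "Suc ?i"] up by (simp add: crossing_def)
    \<comment> \<open>The vertex \<open>crossing s\<close> of \<open>B s\<close> is not identified
      with any other, so \<open>S\<close> cannot leave the ray there.\<close>
    then have "r (Suc ?i) = B s" "x (Suc ?i) = crossing s"
      unfolding f_eq_iff using A_neq_B[of s] by (auto simp: crossing_neq_Suc)
    then show "S (Suc (Suc ?i)) = f (r (st n0)) (Suc (Suc ?i))"
      using S_end[of "Suc ?i"] up s by (simp add: crossing_def)
  qed
  then show ?thesis by blast
qed

end

section \<open>Gluing the rays and scheduling their meetings\<close>

lemma (in stations) glued_rays_exist:
  fixes A B :: "nat \<Rightarrow> 'r" and emb :: "'r \<times> nat \<Rightarrow> 'b"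
  assumes "inj emb" and neq: "\<And>s. A s \<noteq> B s"
  shows "\<exists>f :: 'r \<Rightarrow> nat \<Rightarrow> 'b. crossing_rays ori N A B f"
proof -
  \<comment> \<open>Each class is represented by its member on \<open>A s\<close>; the station is
    determined by the position because \<open>crossing\<close> is injective.\<close>
  define glue where "glue = (\<lambda>r t. if \<exists>s. r = B s \<and> t = Suc (crossing s)
    then let s = THE s. t = Suc (crossing s) in (A s, crossing s) else (r, t))"
  have glue_B: "glue (B s) (Suc (crossing s)) = (A s, crossing s)" for s
    by (auto simp: glue_def Let_def)
  have glue_other: "glue r t = (r, t)" if "\<not> (\<exists>s. r = B s \<and> t = Suc (crossing s))" for r t
    unfolding glue_def using that by (rule if_not_P)
  have glue_A: "glue (A s) (crossing s) = (A s, crossing s)" for s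
    by (rule glue_other) (simp add: crossing_neq_Suc)
  have "glue r t = glue r' t' \<longleftrightarrow> r = r' \<and> t = t' \<or>
      (\<exists>s. (r, t) = (A s, crossing s) \<and> (r', t') = (B s, Suc (crossing s)) \<or>
           (r', t') = (A s, crossing s) \<and> (r, t) = (B s, Suc (crossing s)))" (is "?L \<longleftrightarrow> ?R")
    for r t r' t'
  proof
    assume ?L
    then show ?R
    proof (cases "\<exists>s. r = B s \<and> t = Suc (crossing s)")
      case True
      then obtain s where s: "r = B s" "t = Suc (crossing s)" by blast
      show ?thesis
      proof (cases "\<exists>s. r' = B s \<and> t' = Suc (crossing s)")
        case True
        then show ?thesis using \<open>?L\<close> s by (auto simp: glue_B)
      next
        case False
        then show ?thesis using \<open>?L\<close> s by (auto simp: glue_B glue_other)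
      qed
    next
      case r: False
      show ?thesis
      proof (cases "\<exists>s. r' = B s \<and> t' = Suc (crossing s)")
        case True
        then show ?thesis using \<open>?L\<close> r by (auto simp: glue_B glue_other)
      next
        case False
        then show ?thesis using \<open>?L\<close> r by (simp add: glue_other)
      qed
    qed
  next
    assume ?R
    then show ?L by (auto simp: glue_A glue_B)
  qed
  then have "crossing_rays ori N A B (\<lambda>r t. emb (glue r t))"
    by unfold_locales (use neq in \<open>auto simp: inj_eq[OF \<open>inj emb\<close>]\<close>)
  then show ?thesis by (rule exI[of "\<lambda>f. crossing_rays ori N A B f" "\<lambda>r t. emb (glue r t)"])
qed

text \<open>Copies are pairs whose first component is the family. Each ordered pair of copies from
  different families recurs infinitely often, so copies that follow them only eventually still
  meet.\<close>

lemma crossing_schedule: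
  obtains A B :: "nat \<Rightarrow> nat \<times> nat"
  where "\<And>s. fst (A s) \<noteq> fst (B s)"
    and "\<And>\<rho> \<sigma> n. fst \<rho> \<noteq> fst \<sigma> \<Longrightarrow> \<exists>s\<ge>n. A s = \<rho> \<and> B s = \<sigma>"
proof -
  \<comment> \<open>The additional number makes every pair of copies occur infinitely often in an
    enumeration of \<open>X\<close>.\<close>
  define X :: "(((nat \<times> nat) \<times> (nat \<times> nat)) \<times> nat) set"
    where "X = {((\<rho>, \<sigma>), n). fst \<rho> \<noteq> fst \<sigma>}"
  define e where "e = from_nat_into X"
  have "((((0, 0), (1, 0)), 0) :: ((nat \<times> nat) \<times> (nat \<times> nat)) \<times> nat) \<in> X" by (simp add: X_def)
  then have range_e: "range e = X"
    unfolding e_def by (intro range_from_nat_into) auto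
  show thesis
  proof
    show "fst ((fst \<circ> fst \<circ> e) s) \<noteq> fst ((snd \<circ> fst \<circ> e) s)" for s
    proof -
      have "e s \<in> X" using range_e by blast
      then show ?thesis by (auto simp: X_def)
    qed
    fix \<rho> \<sigma> :: "nat \<times> nat" and n
    assume neq: "fst \<rho> \<noteq> fst \<sigma>"
    let ?Y = "{s. fst (e s) = (\<rho>, \<sigma>)}"
    have "UNIV \<subseteq> (snd \<circ> e) ` ?Y"
    proof
      fix k :: nat
      have "((\<rho>, \<sigma>), k) \<in> range e" using neq range_e by (simp add: X_def)
      then obtain s where "e s = ((\<rho>, \<sigma>), k)" by force
      then show "k \<in> (snd \<circ> e) ` ?Y" by (intro image_eqI[of _ _ s]) simp_all
    qed
    then have "infinite ?Y"
      using infinite_UNIV_nat finite_subset by blast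
    then obtain s where "s \<ge> n" "fst (e s) = (\<rho>, \<sigma>)"
      by (auto simp: infinite_nat_iff_unbounded_le)
    then show "\<exists>s\<ge>n. (fst \<circ> fst \<circ> e) s = \<rho> \<and> (snd \<circ> fst \<circ> e) s = \<sigma>" by auto
  qed
qed

section \<open>The host digraph\<close>

definition ray_arc :: "(nat \<Rightarrow> bool) \<Rightarrow> (nat \<Rightarrow> 'a) \<Rightarrow> nat \<Rightarrow> 'a \<times> 'a" where
  "ray_arc ori v t = (if ori t then (v t, v (Suc t)) else (v (Suc t), v t))"

definition ray_digraph :: "(nat \<Rightarrow> bool) \<Rightarrow> (nat \<Rightarrow> 'a) \<Rightarrow> 'a pair_pre_digraph" where
  "ray_digraph ori v = \<lparr> pverts = range v, parcs = range (ray_arc ori v) \<rparr>"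

lemma ray_digraph_simps [simp]:
  "pverts (ray_digraph ori v) = range v"
  "parcs (ray_digraph ori v) = range (ray_arc ori v)"
  by (simp_all add: ray_digraph_def)

lemma wf_ray_digraph: "wf_digraph (with_proj (ray_digraph ori v))"
  by unfold_locales (auto simp: ray_arc_def)

lemma digraph_iso_ray_digraph:
  assumes "inj v" "inj w"
  shows "digraph_iso (with_proj (ray_digraph ori v)) (with_proj (ray_digraph ori w))"
proof -
  define g where "g = w \<circ> inv v"
  have g: "g (v t) = w t" for t using assms(1) by (simp add: g_def)
  have inj_g: "inj_on g (range v)"
    by (rule inj_onI) (use assms g in \<open>auto dest: injD\<close>)
  have g_arc: "map_prod g g (ray_arc ori v t) = ray_arc ori w t" for t
    by (simp add: ray_arc_def g)
  let ?hom = "\<lparr> iso_verts = g, iso_arcs = map_prod g g, iso_head = snd, iso_tail = fst \<rparr>"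
  have sub: "range (ray_arc ori v) \<subseteq> range v \<times> range v" by (auto simp: ray_arc_def)
  have "inj_on (map_prod g g) (range (ray_arc ori v))"
    using map_prod_inj_on[OF inj_g inj_g] sub by (rule inj_on_subset)
  then have "pre_digraph.digraph_isomorphism (with_proj (ray_digraph ori v)) ?hom"
    unfolding pre_digraph.digraph_isomorphism_def using inj_g wf_ray_digraph by auto
  moreover have "with_proj (ray_digraph ori w) = app_iso ?hom (with_proj (ray_digraph ori v))"
    by (simp add: app_iso_def with_proj_def image_image g g_arc)
  ultimately show ?thesis unfolding digraph_iso_def by blast
qed

lemma copy_of_ray_digraph:
  assumes "subgraph K (with_proj G)" and "digraph_iso (with_proj (ray_digraph ori v)) K"
  obtains S where "verts K = range S" "\<And>t. ray_arc ori S t \<in> parcs G"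
proof -
  let ?R = "with_proj (ray_digraph ori v)"
  obtain hom where hom: "pre_digraph.digraph_isomorphism ?R hom" "K = app_iso hom ?R"
    using assms(2) unfolding digraph_iso_def by blast
  \<comment> \<open>Being a subgraph of \<open>with_proj G\<close> forces the projections on
    \<open>K\<close>, so the image of an arc is determined by the images of its ends.\<close>
  have proj: "iso_tail hom = fst" "iso_head hom = snd"
    using assms(1) hom(2) by (auto simp: subgraph_def compatible_def)
  let ?S = "iso_verts hom \<circ> v"
  show thesis
  proof
    show "verts K = range ?S" using hom(2) by (simp add: image_comp)
    fix t
    let ?e = "ray_arc ori v t"
    have "iso_arcs hom ?e = (iso_verts hom (fst ?e), iso_verts hom (snd ?e))"
      using hom(1) proj by (simp add: pre_digraph.digraph_isomorphism_def prod_eq_iff)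
    also have "\<dots> = ray_arc ori ?S t" by (simp add: ray_arc_def)
    finally have "ray_arc ori ?S t \<in> arcs K" using hom(2) by (metis app_iso_simps(2) image_eqI
          rangeI ray_digraph_simps(2) with_proj_simps(2))
    then show "ray_arc ori ?S t \<in> parcs G" using assms(1) by (auto simp: subgraph_def)
  qed
qed

context crossing_rays
begin

definition host :: "'r set \<Rightarrow> 'b pair_pre_digraph" where
  "host I = \<lparr> pverts = (\<Union>r\<in>I. range (f r)), parcs = (\<Union>r\<in>I. range (ray_arc ori (f r))) \<rparr>"

lemma host_simps [simp]:
  "pverts (host I) = (\<Union>r\<in>I. range (f r))"
  "parcs (host I) = (\<Union>r\<in>I. range (ray_arc ori (f r)))"
  by (simp_all add: host_def)

lemma inj_f: "inj (f r)"
proof (rule injI)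
  fix t t' assume "f r t = f r t'"
  then show "t = t'" unfolding f_eq_iff using A_neq_B by fastforce
qed

lemma pair_loopfree_digraph_host: "pair_loopfree_digraph (host I)"
proof unfold_locales
  fix e assume "e \<in> parcs (host I)"
  then obtain r t where "r \<in> I" "e = ray_arc ori (f r) t" by auto
  then show "fst e \<in> pverts (host I)" "snd e \<in> pverts (host I)" "fst e \<noteq> snd e"
    using inj_eq[OF inj_f] by (auto simp: ray_arc_def)
qed

lemma subgraph_host: "r \<in> I \<Longrightarrow> subgraph (with_proj (ray_digraph ori (f r))) (with_proj (host I))"
  using pair_loopfree_digraph_host[of I]
  by (auto simp: subgraph_def wf_digraph_wp_iff[of "host I"] wf_ray_digraph pair_loopfree_digraph_def)

lemma copy_in_host_follows_ray:
  assumes "subgraph K (with_proj (host I))" and "digraph_iso (with_proj (ray_digraph ori v)) K"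
  shows "\<exists>\<rho>\<in>I. \<exists>n0. \<forall>n\<ge>n0. f \<rho> (st n) \<in> verts K \<and> f \<rho> (Suc (st n)) \<in> verts K \<and>
     (\<forall>s. n = N s \<longrightarrow> \<rho> = B s \<longrightarrow> f \<rho> (Suc (Suc (st n))) \<in> verts K)"
proof -
  obtain S where S: "verts K = range S" "\<And>t. ray_arc ori S t \<in> parcs (host I)"
    using copy_of_ray_digraph[OF assms] by blast
  have "\<exists>r x. r \<in> I \<and> ray_arc ori S i = ray_arc ori (f r) x" for i
    using S(2)[of i] by auto
  then obtain r x where rx: "\<And>i. r i \<in> I" "\<And>i. ray_arc ori S i = ray_arc ori (f (r i)) (x i)"
    by metis
  \<comment> \<open>An arc of \<open>S\<close> equals a host arc; their ends correspond in ray order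
    exactly if the two orientations agree, which gives the choice of \<open>up\<close>.\<close>
  interpret traced_ray ori N A B f S r x "\<lambda>i. ori i = ori (x i)"
  proof unfold_locales
    fix i
    show "S i = f (r i) (if ori i = ori (x i) then x i else Suc (x i))"
      "S (Suc i) = f (r i) (if ori i = ori (x i) then Suc (x i) else x i)"
      using rx(2)[of i] by (auto simp: ray_arc_def split: if_splits)
    show "ori (x i) \<longleftrightarrow> ori i = (ori i = ori (x i))" by auto
  qed
  obtain i n0 where follow: "\<forall>n\<ge>n0. S (st n) = f (r i) (st n) \<and> S (Suc (st n)) = f (r i) (Suc (st n)) \<and>
     (\<forall>s. n = N s \<longrightarrow> r i = B s \<longrightarrow> S (Suc (Suc (st n))) = f (r i) (Suc (Suc (st n))))"
    using eventually_follows_ray by blast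
  have in_K: "S j \<in> verts K" for j using S(1) by blast
  show ?thesis
  proof (intro bexI[of _ "r i"] exI[of _ n0] allI impI conjI)
    fix n assume n: "n0 \<le> n"
    show "f (r i) (st n) \<in> verts K" "f (r i) (Suc (st n)) \<in> verts K"
      using follow n in_K by metis+
    show "f (r i) (Suc (Suc (st n))) \<in> verts K" if "n = N s" "r i = B s" for s
      using follow n in_K that by metis
  qed (rule rx(1))
qed

end

theorem alternating_ray_not_ubiquitous:
  fixes v :: "nat \<Rightarrow> 'a"
  assumes "alternating ori" "\<And>b. \<exists>n. b \<le> alternating.len ori n" "inj v"
    and inf: "infinite (UNIV :: 'b set)"
  shows "\<not> ubiquitous TYPE('b) (ray_digraph ori v)"
proof
  assume ubiq: "ubiquitous TYPE('b) (ray_digraph ori v)"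
  interpret alternating ori by fact
  obtain N where "stations ori N" using stations_exist assms(2) by blast
  then interpret stations ori N .
  \<comment> \<open>Vertices of the host are named inside the given infinite type.\<close>
  obtain g :: "nat \<Rightarrow> 'b" where "inj g" using infinite_countable_subset[OF inf] by blast
  then have inj: "inj (g \<circ> to_nat :: (nat \<times> nat) \<times> nat \<Rightarrow> 'b)" by (simp add: inj_compose)
  obtain A B :: "nat \<Rightarrow> nat \<times> nat" where neq: "\<And>s. fst (A s) \<noteq> fst (B s)"
    and sched: "\<And>\<rho> \<sigma> n. fst \<rho> \<noteq> fst \<sigma> \<Longrightarrow> \<exists>s\<ge>n. A s = \<rho> \<and> B s = \<sigma>"
    using crossing_schedule by blast
  obtain f :: "nat \<times> nat \<Rightarrow> nat \<Rightarrow> 'b" where "crossing_rays ori N A B f"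
    using glued_rays_exist[OF inj, of A B] neq by metis
  then interpret crossing_rays ori N A B f .
  \<comment> \<open>Family \<open>k\<close> has exactly the \<open>k\<close> members
    \<open>(k, i)\<close> with \<open>i < k\<close>.\<close>
  define I where "I = {(k :: nat, i). i < k}"
  let ?R = "with_proj (ray_digraph ori v)"
  let ?copy = "\<lambda>r. with_proj (ray_digraph ori (f r))"
  have "\<exists>F. disjoint_copies (ray_digraph ori v) (host I) F \<and> finite F \<and> card F = k" for k
  proof -
    let ?F = "?copy ` ({k} \<times> {..<k})"
    \<comment> \<open>Identifications join different families only.\<close>
    have disj: "range (f r) \<inter> range (f r') = {}"
      if "r \<noteq> r'" "fst r = fst r'" for r r'
    proof -
      have "f r t \<noteq> f r' t'" for t t' unfolding f_eq_iff using that neq by (metis prod.inject)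
      then show ?thesis by blast
    qed
    have "inj_on ?copy ({k} \<times> {..<k})"
    proof (rule inj_onI)
      fix r r' assume r: "r \<in> {k} \<times> {..<k}" "r' \<in> {k} \<times> {..<k}" and "?copy r = ?copy r'"
      then have "range (f r) = range (f r')" by (metis ray_digraph_simps(1) with_proj_simps(1))
      then have "range (f r) \<inter> range (f r') \<noteq> {}" by simp
      moreover have "fst r = fst r'" using r by auto
      ultimately show "r = r'" using disj[of r r'] by blast
    qed
    then have "card ?F = k" by (simp add: card_image)
    moreover have "disjoint_copies (ray_digraph ori v) (host I) ?F"
      unfolding disjoint_copies_def
    proof (intro conjI ballI)
      fix K assume "K \<in> ?F"
      then obtain r where r: "r \<in> {k} \<times> {..<k}" "K = ?copy r" by blast
      then have "r \<in> I" by (auto simp: I_def)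
      then show "subgraph K (with_proj (host I))" using r(2) subgraph_host by blast
      show "digraph_iso ?R K" using r(2) digraph_iso_ray_digraph[OF \<open>inj v\<close> inj_f] by blast
    next
      show "pairwise (\<lambda>K L. disjnt (verts K) (verts L)) ?F"
      proof (rule pairwiseI)
        fix K L assume "K \<in> ?F" "L \<in> ?F" "K \<noteq> L"
        then obtain r r' where r: "r \<in> {k} \<times> {..<k}" "r' \<in> {k} \<times> {..<k}" "r \<noteq> r'"
          and KL: "K = ?copy r" "L = ?copy r'"
          by blast
        have "fst r = fst r'" using r by auto
        then show "disjnt (verts K) (verts L)" using disj[OF r(3)] KL by (simp add: disjnt_def)
      qed
    qed
    ultimately show ?thesis by (intro exI[of _ ?F]) simp
  qed
  then obtain F where F: "disjoint_copies (ray_digraph ori v) (host I) F" "infinite F"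
    using ubiq pair_loopfree_digraph_host[of I] unfolding ubiquitous_def by blast
  define follows where "follows K \<rho> n0 \<longleftrightarrow> \<rho> \<in> I \<and>
    (\<forall>n\<ge>n0. f \<rho> (st n) \<in> verts K \<and> f \<rho> (Suc (st n)) \<in> verts K \<and>
     (\<forall>s. n = N s \<longrightarrow> \<rho> = B s \<longrightarrow> f \<rho> (Suc (Suc (st n))) \<in> verts K))"
    for K :: "('b, 'b \<times> 'b) pre_digraph" and \<rho> n0
  have "\<exists>\<rho> n0. follows K \<rho> n0" if "K \<in> F" for K
    using copy_in_host_follows_ray[of K I v] F(1) that
    unfolding disjoint_copies_def follows_def by blast
  then obtain \<rho> n0 where "\<And>K. K \<in> F \<Longrightarrow> follows K (\<rho> K) (n0 K)"
    by metis
  then have \<rho>: "\<And>K. K \<in> F \<Longrightarrow> \<rho> K \<in> I"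
    and follow: "\<And>K n. K \<in> F \<Longrightarrow> n \<ge> n0 K \<Longrightarrow> f (\<rho> K) (st n) \<in> verts K"
      "\<And>K n. K \<in> F \<Longrightarrow> n \<ge> n0 K \<Longrightarrow> f (\<rho> K) (Suc (st n)) \<in> verts K"
      "\<And>K s. K \<in> F \<Longrightarrow> N s \<ge> n0 K \<Longrightarrow> \<rho> K = B s \<Longrightarrow> f (\<rho> K) (Suc (Suc (st (N s)))) \<in> verts K"
    by (simp_all add: follows_def)
  have disj: "verts K \<inter> verts L = {}" if "K \<in> F" "L \<in> F" "K \<noteq> L" for K L
    using F(1) that unfolding disjoint_copies_def pairwise_def disjnt_def by blast
  \<comment> \<open>Two copies following the same ray would share the starts of all late
    phases.\<close>
  have "inj_on \<rho> F"
  proof (rule inj_onI, rule ccontr)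
    fix K L assume KL: "K \<in> F" "L \<in> F" "\<rho> K = \<rho> L" "K \<noteq> L"
    let ?n = "max (n0 K) (n0 L)"
    show False using follow(1)[of K ?n] follow(1)[of L ?n] KL disj[of K L] by auto
  qed
  moreover have "finite (\<rho> ` F)"
  proof -
    obtain K where K: "K \<in> F" using F(2) by fastforce
    have "fst (\<rho> L) = fst (\<rho> K)" if L: "L \<in> F" for L
    proof (rule ccontr)
      assume fam: "fst (\<rho> L) \<noteq> fst (\<rho> K)"
      \<comment> \<open>At a late station joining the two rays, \<open>L\<close> contains the
        identified vertex as a vertex of \<open>A s\<close> and \<open>K\<close> contains it as a
        vertex of \<open>B s\<close>.\<close>
      then obtain s where s: "s \<ge> max (n0 K) (n0 L)" "A s = \<rho> L" "B s = \<rho> K"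
        using sched by blast
      have n: "N s \<ge> n0 K" "N s \<ge> n0 L" using s(1) le_N[of s] by auto
      have "f (A s) (crossing s) \<in> verts L"
        using follow(2)[OF L n(2)] s by (simp add: crossing_def)
      moreover have "f (B s) (Suc (crossing s)) \<in> verts K"
        using follow(3)[OF K n(1)] s by (simp add: crossing_def)
      moreover have "f (A s) (crossing s) = f (B s) (Suc (crossing s))"
        unfolding f_eq_iff by blast
      ultimately show False using disj[of K L] K L fam by auto
    qed
    then have "\<rho> ` F \<subseteq> {fst (\<rho> K)} \<times> {..<fst (\<rho> K)}"
      using \<rho> by (fastforce simp: I_def)
    then show ?thesis by (rule finite_subset) simp
  qed
  ultimately show False using F(2) finite_imageD by blast
qed

section \<open>The representing sequence\<close>

lemma enumerates_ray_adjacent: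
  assumes "enumerates_ray v U"
  shows "(v i, y) \<in> parcs U \<longleftrightarrow> y = v (Suc i) \<or> (\<exists>j. i = Suc j \<and> y = v j)"
  using assms by (auto simp: enumerates_ray_def dest: injD)

text \<open>The vertex \<open>w 0\<close> has a single neighbour, which forces
  \<open>w 0 = v 0\<close>; afterwards the next vertex is the only neighbour not yet
  visited.\<close>

lemma enumerates_ray_unique:
  assumes v: "enumerates_ray v U" and w: "enumerates_ray w U"
  shows "v = w"
proof -
  have inj: "inj v" "inj w" and ranges: "range v = range w"
    using v w by (auto simp: enumerates_ray_def)
  have "w 0 \<in> range v" using ranges by blast
  then obtain j where j: "w 0 = v j" by blast
  have "j = 0"
  proof (rule ccontr)
    assume "j \<noteq> 0"
    then obtain j' where j': "j = Suc j'" using not0_implies_Suc by blast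
    have "(w 0, v (Suc j)) \<in> parcs U" "(w 0, v j') \<in> parcs U"
      unfolding j enumerates_ray_adjacent[OF v] using j' by auto
    then have "v (Suc j) = w 1" "v j' = w 1"
      unfolding enumerates_ray_adjacent[OF w] by auto
    then have "Suc j = j'" using inj by (metis injD)
    then show False using j' by simp
  qed
  have "\<forall>i\<le>n. v i = w i" for n
  proof (induction n)
    case 0
    show ?case using j \<open>j = 0\<close> by simp
  next
    case (Suc n)
    have "(v n, v (Suc n)) \<in> parcs U" unfolding enumerates_ray_adjacent[OF v] by simp
    then have "(w n, v (Suc n)) \<in> parcs U" using Suc by simp
    then have "v (Suc n) = w (Suc n) \<or> (\<exists>j. n = Suc j \<and> v (Suc n) = w j)"
      unfolding enumerates_ray_adjacent[OF w] .
    moreover have "v (Suc n) \<noteq> w j" if "n = Suc j" for j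
      using Suc that inj by (metis injD le_SucI le_refl lessI less_irrefl_nat Suc_lessD)
    ultimately show ?case using Suc by (auto simp: le_Suc_eq)
  qed
  then show ?thesis by blast
qed

text \<open>The pattern \<open>ori\<close> is read off from the arcs. Each edge of the underlying
  ray carries some arc, and by antisymmetry only one.\<close>

lemma oriented_ray_cases:
  assumes "oriented_ray R"
  obtains ori v where "inj v" "R = ray_digraph ori v" "ray_vertex R = v"
proof -
  obtain v where v: "enumerates_ray v (mk_symmetric R)" and anti: "antisym (parcs R)"
    using assms by (auto simp: oriented_ray_def)
  define ori where "ori = (\<lambda>t. (v t, v (Suc t)) \<in> parcs R)"
  have inj: "inj v" and verts: "pverts R = range v"
    using v by (auto simp: enumerates_ray_def)
  have sym: "(a, b) \<in> parcs R \<or> (b, a) \<in> parcs R \<longleftrightarrow>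
      (\<exists>n. (a, b) = (v n, v (Suc n)) \<or> (a, b) = (v (Suc n), v n))" for a b
  proof -
    have "(a, b) \<in> parcs (mk_symmetric R) \<longleftrightarrow> (\<exists>n. (a, b) = (v n, v (Suc n)) \<or> (a, b) = (v (Suc n), v n))"
      using v by (auto simp: enumerates_ray_def)
    then show ?thesis by (force simp: parcs_mk_symmetric)
  qed
  have "parcs R = range (ray_arc ori v)"
  proof (intro set_eqI iffI)
    fix e assume e: "e \<in> parcs R"
    then obtain n where "e = (v n, v (Suc n)) \<or> e = (v (Suc n), v n)"
      using sym[of "fst e" "snd e"] by (cases e) auto
    then have "e = ray_arc ori v n"
      using e antisymD[OF anti, of "v n" "v (Suc n)"] inj_eq[OF inj, of n "Suc n"]
      by (auto simp: ray_arc_def ori_def)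
    then show "e \<in> range (ray_arc ori v)" by blast
  next
    fix e assume "e \<in> range (ray_arc ori v)"
    then obtain n where "e = ray_arc ori v n" by blast
    then show "e \<in> parcs R"
      using sym[of "v n" "v (Suc n)"] by (auto simp: ray_arc_def ori_def)
  qed
  then have "R = ray_digraph ori v" using verts by (simp add: ray_digraph_def)
  moreover have "ray_vertex R = v"
    unfolding ray_vertex_def using v enumerates_ray_unique by (intro the_equality)
  ultimately show thesis using inj by (intro that)
qed

section \<open>Phases as segments of the ray\<close>

locale oriented_ray_pattern = alternating ori for ori +
  fixes v :: "nat \<Rightarrow> 'a"
  assumes inj_v: "inj v"
    and ray_vertex_eq: "ray_vertex (ray_digraph ori v) = v"
begin

abbreviation R :: "'a pair_pre_digraph" where
  "R \<equiv> ray_digraph ori v"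

definition segment :: "nat \<Rightarrow> nat \<Rightarrow> ('a, 'a \<times> 'a) pre_digraph" where
  "segment a b = with_proj \<lparr> pverts = v ` {a..b}, parcs = ray_arc ori v ` {a..<b} \<rparr>"

lemma v_eq_iff [simp]: "v i = v j \<longleftrightarrow> i = j"
  using inj_v by (rule inj_eq)

lemma inj_ray_arc: "inj (ray_arc ori v)"
  by (rule injI) (auto simp: ray_arc_def split: if_splits)

lemma segment_simps [simp]:
  "verts (segment a b) = v ` {a..b}" "arcs (segment a b) = ray_arc ori v ` {a..<b}"
  "tail (segment a b) = fst" "head (segment a b) = snd"
  by (simp_all add: segment_def)

lemma subgraph_segment:
  assumes "a' \<le> a" "b \<le> b'"
  shows "subgraph (segment a b) (segment a' b')"
proof -
  have "wf_digraph (segment c d)" for c d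
    by unfold_locales (auto simp: ray_arc_def)
  then show ?thesis using assms by (auto simp: subgraph_def compatible_def)
qed

lemma subgraph_segment_R: "subgraph (segment a b) (with_proj R)"
proof -
  have "wf_digraph (segment a b)"
    by unfold_locales (auto simp: ray_arc_def)
  then show ?thesis using wf_ray_digraph by (auto simp: subgraph_def compatible_def)
qed

text \<open>The first arc decides the direction: turning back later would revisit a vertex, so all
  arcs of the path are oriented alike.\<close>

lemma path_in_ray:
  assumes "pcas (v i) p w" "set p \<subseteq> range (ray_arc ori v)" "distinct (pawalk_verts (v i) p)"
  shows "(set (pawalk_verts (v i) p) = v ` {i..i + length p} \<and>
      set p = ray_arc ori v ` {i..<i + length p} \<and> (\<forall>t\<in>{i..<i + length p}. ori t)) \<or>
    (length p \<le> i \<and> set (pawalk_verts (v i) p) = v ` {i - length p..i} \<and>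
      set p = ray_arc ori v ` {i - length p..<i} \<and> (\<forall>t\<in>{i - length p..<i}. \<not> ori t))"
  using assms
proof (induction p arbitrary: i)
  case Nil
  then show ?case by simp
next
  case (Cons e es)
  obtain t where t: "e = ray_arc ori v t" using Cons.prems(2) by auto
  have e: "fst e = v i" and es: "pcas (snd e) es w" "set es \<subseteq> range (ray_arc ori v)"
    "distinct (pawalk_verts (snd e) es)" "v i \<notin> set (pawalk_verts (snd e) es)"
    using Cons.prems by auto
  show ?case
  proof (cases "ori t")
    case True
    then have ti: "t = i" "snd e = v (Suc i)" using t e by (auto simp: ray_arc_def)
    \<comment> \<open>A nonempty rest going down from \<open>v (Suc i)\<close> would pass through
      \<open>v i\<close> again; for the empty rest both alternatives of the induction hypothesis
      coincide.\<close>
    have "\<not> (1 \<le> length es \<and> length es \<le> Suc i \<and>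
        set (pawalk_verts (v (Suc i)) es) = v ` {Suc i - length es..Suc i})"
      using es(4) ti by auto
    then have IH: "set (pawalk_verts (v (Suc i)) es) = v ` {Suc i..Suc i + length es}"
      "set es = ray_arc ori v ` {Suc i..<Suc i + length es}" "\<forall>t\<in>{Suc i..<Suc i + length es}. ori t"
      using Cons.IH[of "Suc i"] es ti by (cases "es = []"; force)+
    have "{i..i + length (e # es)} = insert i {Suc i..Suc i + length es}"
      "{i..<i + length (e # es)} = insert i {Suc i..<Suc i + length es}" by auto
    then show ?thesis using IH True t ti e by simp
  next
    case False
    then have ti: "i = Suc t" "snd e = v t" using t e by (auto simp: ray_arc_def)
    have "\<not> (1 \<le> length es \<and> set (pawalk_verts (v t) es) = v ` {t..t + length es})"
      using es(4) ti by auto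
    then have IH: "length es \<le> t" "set (pawalk_verts (v t) es) = v ` {t - length es..t}"
      "set es = ray_arc ori v ` {t - length es..<t}" "\<forall>t\<in>{t - length es..<t}. \<not> ori t"
      using Cons.IH[of t] es ti by (cases "es = []"; force)+
    have "{i - length (e # es)..i} = insert i {t - length es..t}"
      "{i - length (e # es)..<i} = insert t {t - length es..<t}" using IH(1) ti by auto
    then show ?thesis using IH False t ti e by simp
  qed
qed

lemma dipath_is_segment:
  assumes "subgraph P (with_proj R)" "dipath P"
  obtains a b where "a \<le> b" "P = segment a b" "\<And>t. t \<in> {a..<b} \<Longrightarrow> ori t = ori a"
proof -
  obtain u p w where path: "pre_digraph.apath P u p w" "verts P = set (pre_digraph.awalk_verts P u p)"
      "arcs P = set p"
    using assms(2) unfolding dipath_def by blast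
  have comp: "compatible (with_proj R) P" and sub: "verts P \<subseteq> range v" "arcs P \<subseteq> range (ray_arc ori v)"
    using assms(1) by (auto simp: subgraph_def)
  have eqs: "pre_digraph.cas P = pcas" "pre_digraph.awalk_verts P = pawalk_verts"
    using compatible_cas[OF comp] compatible_awalk_verts[OF comp]
    by (simp_all add: cas_with_proj_eq awalk_verts_with_proj_eq)
  have p: "u \<in> verts P" "pcas u p w" "distinct (pawalk_verts u p)"
    using path(1) unfolding pre_digraph.apath_def pre_digraph.awalk_def eqs by auto
  then obtain i where i: "u = v i" using sub by blast
  have P_eq: "P = segment a b" if "verts P = v ` {a..b}" "arcs P = ray_arc ori v ` {a..<b}" for a b
    using that comp by (intro pre_digraph.equality) (auto simp: compatible_def)
  have verts_P: "verts P = set (pawalk_verts (v i) p)" using path(2) eqs i by simp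
  consider "set (pawalk_verts (v i) p) = v ` {i..i + length p}"
      "set p = ray_arc ori v ` {i..<i + length p}" "\<forall>t\<in>{i..<i + length p}. ori t"
    | "set (pawalk_verts (v i) p) = v ` {i - length p..i}"
      "set p = ray_arc ori v ` {i - length p..<i}" "\<forall>t\<in>{i - length p..<i}. \<not> ori t"
    using path_in_ray[of i p w] p i sub path(3) by auto
  then show thesis
  proof cases
    case 1
    show thesis
      by (rule that[OF _ P_eq]) (use 1 verts_P path(3) in auto)
  next
    case 2
    show thesis
      by (rule that[OF _ P_eq]) (use 2 verts_P path(3) in auto)
  qed
qed

lemma dipath_segment:
  assumes "\<And>t. t \<in> {a..<b} \<Longrightarrow> ori t = ori a" "a \<le> b"
  shows "dipath (segment a b)"
proof -
  have out: "\<exists>p. pcas (v c) p (v (c + n)) \<and> distinct (pawalk_verts (v c) p) \<and>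
      set (pawalk_verts (v c) p) = v ` {c..c + n} \<and> set p = ray_arc ori v ` {c..<c + n}"
    if "\<forall>t\<in>{c..<c + n}. ori t" for c n
    using that
  proof (induction n arbitrary: c)
    case 0
    show ?case by (rule exI[of _ "[]"]) simp
  next
    case (Suc n)
    then obtain p where p: "pcas (v (Suc c)) p (v (Suc c + n))" "distinct (pawalk_verts (v (Suc c)) p)"
      "set (pawalk_verts (v (Suc c)) p) = v ` {Suc c..Suc c + n}"
      "set p = ray_arc ori v ` {Suc c..<Suc c + n}"
      using Suc.IH[of "Suc c"] by auto
    have "ori c" using Suc.prems by simp
    then have arc: "ray_arc ori v c = (v c, v (Suc c))" by (simp add: ray_arc_def)
    have "{c..c + Suc n} = insert c {Suc c..Suc c + n}"
      "{c..<c + Suc n} = insert c {Suc c..<Suc c + n}" by auto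
    then show ?case using p arc by (intro exI[of _ "ray_arc ori v c # p"]) auto
  qed
  \<comment> \<open>Here the dipath starts at the far end, so the induction prepends the arc with
    the largest index and keeps \<open>c\<close> fixed.\<close>
  have inw: "\<exists>p. pcas (v (c + n)) p (v c) \<and> distinct (pawalk_verts (v (c + n)) p) \<and>
      set (pawalk_verts (v (c + n)) p) = v ` {c..c + n} \<and> set p = ray_arc ori v ` {c..<c + n}"
    if "\<forall>t\<in>{c..<c + n}. \<not> ori t" for c n
    using that
  proof (induction n)
    case 0
    show ?case by (rule exI[of _ "[]"]) simp
  next
    case (Suc n)
    then obtain p where p: "pcas (v (c + n)) p (v c)" "distinct (pawalk_verts (v (c + n)) p)"
      "set (pawalk_verts (v (c + n)) p) = v ` {c..c + n}"
      "set p = ray_arc ori v ` {c..<c + n}"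
      by auto
    have "\<not> ori (c + n)" using Suc.prems by simp
    then have arc: "ray_arc ori v (c + n) = (v (c + Suc n), v (c + n))" by (simp add: ray_arc_def)
    have "{c..c + Suc n} = insert (c + Suc n) {c..c + n}"
      "{c..<c + Suc n} = insert (c + n) {c..<c + n}" by auto
    then show ?case using p arc by (intro exI[of _ "ray_arc ori v (c + n) # p"]) auto
  qed
  obtain u p w where p: "u \<in> v ` {a..b}" "pcas u p w" "distinct (pawalk_verts u p)"
    "set (pawalk_verts u p) = v ` {a..b}" "set p = ray_arc ori v ` {a..<b}"
  proof (cases "ori a")
    case True
    then show thesis using out[of a "b - a"] assms that[of "v a"] by auto
  next
    case False
    then show thesis using inw[of a "b - a"] assms that[of "v b"] by auto
  qed
  then have "pre_digraph.apath (segment a b) u p w \<and>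
      verts (segment a b) = set (pre_digraph.awalk_verts (segment a b) u p) \<and> arcs (segment a b) = set p"
    unfolding pre_digraph.apath_def pre_digraph.awalk_def
    by (simp add: segment_def cas_with_proj_eq awalk_verts_with_proj_eq)
  then show ?thesis unfolding dipath_def by blast
qed

lemma phase_is_segment:
  assumes "P \<in> phases R"
  obtains a b where "a \<le> b" "P = segment a b" "\<And>t. t \<in> {a..<b} \<Longrightarrow> ori t = ori a"
  using dipath_is_segment assms unfolding phases_def pre_digraph.max_subgraph_def by blast

lemma phase_start_segment: "a \<le> b \<Longrightarrow> phase_start R (segment a b) = a"
  unfolding phase_start_def ray_vertex_eq by (rule Least_equality) auto

text \<open>Segments with a common start are nested, and maximality makes nested phases
  equal.\<close>

lemma inj_on_phase_start: "inj_on (phase_start R) (phases R)"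
proof (rule inj_onI)
  fix P Q assume P: "P \<in> phases R" and Q: "Q \<in> phases R" and eq: "phase_start R P = phase_start R Q"
  obtain a b where ab: "a \<le> b" "P = segment a b" using phase_is_segment[OF P] by metis
  obtain a' b' where ab': "a' \<le> b'" "Q = segment a' b'" using phase_is_segment[OF Q] by metis
  have "a = a'" using eq ab ab' phase_start_segment by simp
  then have "subgraph P Q \<or> subgraph Q P" using ab ab' subgraph_segment nle_le by metis
  moreover have "P' = Q'" if "P' \<in> phases R" "Q' \<in> phases R" "subgraph P' Q'" for P' Q'
    using that by (auto simp: phases_def pre_digraph.max_subgraph_def)
  ultimately show "P = Q" using P Q by metis
qed

text \<open>A longer segment would contain the turn just before \<open>st n\<close> or the one at
  \<open>st (Suc n)\<close>, and hence arcs of both orientations.\<close>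

lemma segment_in_phases: "segment (st n) (st (Suc n)) \<in> phases R"
proof -
  let ?P = "segment (st n) (st (Suc n))"
  have le: "st n < st (Suc n)" by simp
  have straight: "ori t = ori (st n)" if "t \<in> {st n..<st (Suc n)}" for t
    using that ph_eq_iff[of t n] by (intro ori_eq_if_ph_eq) auto
  have dip: "dipath ?P" by (rule dipath_segment[OF straight less_imp_le[OF le]])
  have "Q = ?P" if PQ: "subgraph ?P Q" and Q: "subgraph Q (with_proj R)" "dipath Q" for Q
  proof -
    obtain a b where ab: "a \<le> b" "Q = segment a b" and const: "\<And>t. t \<in> {a..<b} \<Longrightarrow> ori t = ori a"
      using dipath_is_segment[OF Q] by metis
    have "v ` {st n..st (Suc n)} \<subseteq> v ` {a..b}" using PQ ab by (auto simp: subgraph_def)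
    then have sub: "{st n..st (Suc n)} \<subseteq> {a..b}" using inj_image_subset_iff[OF inj_v] by blast
    then have bounds: "a \<le> st n" "st (Suc n) \<le> b" using le by auto
    have "a = st n"
    proof (rule ccontr)
      assume "a \<noteq> st n"
      then have less: "a < st n" using bounds by simp
      then obtain k where k: "st n = Suc k" using less_imp_Suc_add by blast
      have "n \<noteq> 0" using less by (metis not_less0 st_0)
      then obtain n' where n': "n = Suc n'" using not0_implies_Suc by blast
      have "ph k = n'" unfolding ph_eq_iff using k n' strict_mono_st st_less_iff
        by (metis lessI less_Suc_eq_le)
      then have "ori k \<noteq> ori (Suc k)" using ori_change_iff k n' by simp
      moreover have "k \<in> {a..<b}" "Suc k \<in> {a..<b}" using less k bounds le by auto
      ultimately show False using const by metis
    qed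
    moreover have "b = st (Suc n)"
    proof (rule ccontr)
      assume "b \<noteq> st (Suc n)"
      then have less: "st (Suc n) < b" using bounds by simp
      obtain k where k: "st (Suc n) = Suc k" using le less_imp_Suc_add by blast
      have "ph k = n" unfolding ph_eq_iff using k le by simp
      then have "ori k \<noteq> ori (Suc k)" using ori_change_iff k by simp
      moreover have "k \<in> {a..<b}" "Suc k \<in> {a..<b}" using less k bounds le by auto
      ultimately show False using const by metis
    qed
    ultimately show ?thesis using ab by simp
  qed
  then show ?thesis
    unfolding phases_def pre_digraph.max_subgraph_def using dip subgraph_segment_R by blast
qed

text \<open>The segments between turns provide infinitely many phase starts, so
  \<open>enumerate\<close> yields a start, and \<open>inj_on_phase_start\<close> makes the phase
  unique.\<close>

lemma nth_phase_in_phases: "nth_phase R n \<in> phases R"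
proof -
  have "range st \<subseteq> phase_start R ` phases R"
  proof (rule image_subsetI)
    fix n show "st n \<in> phase_start R ` phases R"
      using segment_in_phases[of n] phase_start_segment[of "st n" "st (Suc n)"]
      by (metis imageI less_imp_le lessI st_less_iff)
  qed
  moreover have "infinite (range st)"
    using range_inj_infinite[OF strict_mono_imp_inj_on[OF strict_mono_st]] .
  ultimately have "infinite (phase_start R ` phases R)" using finite_subset by blast
  then have "enumerate (phase_start R ` phases R) n \<in> phase_start R ` phases R"
    by (rule enumerate_in_set)
  then have "\<exists>!P. P \<in> phases R \<and> phase_start R P = enumerate (phase_start R ` phases R) n"
    using inj_on_eq_iff[OF inj_on_phase_start] by auto
  then show ?thesis unfolding nth_phase_def by (rule theI'[THEN conjunct1])
qed

text \<open>A consistently oriented segment lies inside one phase of the pattern. The bound by some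
  \<open>len m\<close> already transfers unboundedness to \<open>len\<close>.\<close>

lemma representing_sequence_le_len: "\<exists>m. representing_sequence R n \<le> len m"
proof -
  obtain a b where ab: "a \<le> b" "nth_phase R n = segment a b"
    and const: "\<And>t. t \<in> {a..<b} \<Longrightarrow> ori t = ori a"
    using phase_is_segment[OF nth_phase_in_phases] by metis
  have ph: "t < b \<Longrightarrow> ph t = ph a" if "a \<le> t" for t
    using that
  proof (induction t rule: dec_induct)
    case (step t)
    then have "ori t = ori (Suc t)" using const[of t] const[of "Suc t"] by simp
    then show ?case using step by simp
  qed simp
  have "{a..<b} \<subseteq> {st (ph a)..<st (Suc (ph a))}"
  proof
    fix t assume "t \<in> {a..<b}"
    then show "t \<in> {st (ph a)..<st (Suc (ph a))}" using ph[of t] ph_eq_iff[of t "ph a"] by simp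
  qed
  then have "card {a..<b} \<le> len (ph a)"
    using card_mono[of "{st (ph a)..<st (Suc (ph a))}" "{a..<b}"] by (simp add: len_def)
  moreover have "representing_sequence R n = card {a..<b}"
    unfolding representing_sequence_def ab(2)
    by (simp add: card_image[OF inj_on_subset[OF inj_ray_arc]])
  ultimately show ?thesis by auto
qed

end

text \<open>A pattern that is constant from some index on leaves only finitely many arcs of one of
  the two kinds.\<close>

lemma alternating_if_infinite_arcs:
  assumes "inj v" "ray_vertex (ray_digraph ori v) = v"
    and "infinite (in_oriented_arcs (ray_digraph ori v))"
    and "infinite (out_oriented_arcs (ray_digraph ori v))"
  shows "alternating ori"
proof -
  let ?R = "ray_digraph ori v"
  have "in_oriented_arcs ?R \<subseteq> ray_arc ori v ` {t. \<not> ori t}"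
    using inj_eq[OF assms(1)] by (fastforce simp: in_oriented_arcs_def assms(2) ray_arc_def split: if_splits)
  then have inw: "infinite {t. \<not> ori t}" using assms(3) finite_subset by blast
  have "out_oriented_arcs ?R \<subseteq> ray_arc ori v ` {t. ori t}"
  proof
    fix e assume e: "e \<in> out_oriented_arcs ?R"
    then obtain t where t: "e = ray_arc ori v t" by (auto simp: out_oriented_arcs_def)
    have "ori t"
    proof (rule ccontr)
      assume "\<not> ori t"
      then have "e \<in> in_oriented_arcs ?R"
        using t unfolding in_oriented_arcs_def assms(2) by (auto simp: ray_arc_def)
      then show False using e by (simp add: out_oriented_arcs_def)
    qed
    then show "e \<in> ray_arc ori v ` {t. ori t}" using t by blast
  qed
  then have out: "infinite {t. ori t}" using assms(4) finite_subset by blast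
  show ?thesis
  proof (unfold_locales, rule ccontr)
    fix n assume const: "\<not> (\<exists>m\<ge>n. ori m \<noteq> ori (Suc m))"
    have "ori m = ori n" if "n \<le> m" for m
      using that
    proof (induction m rule: dec_induct)
      case (step m)
      then show ?case using const by metis
    qed simp
    moreover obtain i j where "i \<ge> n" "\<not> ori i" "j \<ge> n" "ori j"
      using inw out unfolding infinite_nat_iff_unbounded_le by blast
    ultimately show False by metis
  qed
qed

theorem theorem4p4:
  fixes R :: "'a pair_pre_digraph"
  assumes "oriented_ray R"
    and "infinite (in_oriented_arcs R)"
    and "infinite (out_oriented_arcs R)"
    and "unbounded_seq (representing_sequence R)"
    and "infinite (UNIV :: 'b set)"
  shows "\<not> ubiquitous TYPE('b) R"
proof -
  obtain ori v where R: "inj v" "R = ray_digraph ori v" "ray_vertex R = v"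
    using oriented_ray_cases[OF assms(1)] .
  have alt: "alternating ori" using alternating_if_infinite_arcs assms(2,3) R by blast
  interpret alternating ori by (rule alt)
  interpret oriented_ray_pattern ori v by unfold_locales (use R in auto)
  have "\<exists>n. b \<le> len n" for b
    using assms(4) representing_sequence_le_len R(2) unfolding unbounded_seq_def
    by (metis le_trans nle_le)
  then show ?thesis
    unfolding R(2) using alternating_ray_not_ubiquitous[OF alt _ R(1) assms(5)] by blast
qed

end
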